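(* Let $(X,\pi;M_X,I_X)$ and $(Y,\sigma;M_Y,I_Y)$ be impulsive semidynamical systems satisfying the standing assumptions. Let $h:X\to Y$ be an $I$-homomorphism, let $y\in Y$, and let $x\in X_y\setminus M_X$ be a point such that $\overline{\tilde\pi^+(x)}$ is compact, where $X_y=\{z\in X:h(z)=y\}$. Assume that for each point $q\in\tilde L_Y^+(y)$ there is a unique $p\in X$ such that $h(p)=q$. Then $x$ is comparable in limit with $y$, that is, $\mathcal L_y^{+\infty}\subset\mathcal L_x^{+\infty}$.
   Context: Let $\mathbb R_+=[0,+\infty)$. A semidynamical system $(Z,\varrho)$ on a metric space $Z$ is a continuous map $\varrho:Z\times\mathbb R_+\to Z$ with $\varrho(z,0)=z$ and $\varrho(\varrho(z,t),s)=\varrho(z,t+s)$ for all $z\in Z$, $t,s\in\mathbb R_+$. For $z\in Z$, $t\ge 0$ put $F(z,t)=\{w\in Z:\varrho(w,t)=z\}$; for $D\subset Z$, $\Delta\subset[0,+\infty)$ put $F(D,\Delta)=\bigcup_{z\in D,\,t\in\Delta}F(z,t)$ (singletons are written without braces). A point $z$ is an initial point if $F(z,t)=\emptyset$ for all $t>0$. An impulsive semidynamical system (ISS) $(Z,\varrho;M,I)$ consists of a semidynamical system $(Z,\varrho)$, a nonempty closed set $M\subset Z$ such that for every $z\in M$ there is $\epsilon_z>0$ with $F(z,(0,\epsilon_z))\cap M=\emptyset$ and $\varrho(z,(0,\epsilon_z))\cap M=\emptyset$, and a continuous function $I:M\to Z$. Let $\phi(z)\in(0,+\infty]$ be the least $s>0$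 with $\varrho(z,s)\in M$, and $\phi(z)=+\infty$ if no such $s$ exists. The impulsive trajectory $\tilde\varrho(z,\cdot)$ of $z$ is defined inductively: $z_0^+=z$, $t_0=0$; given $z_n^+$ and $t_n$, if $\phi(z_n^+)=+\infty$ then $\tilde\varrho(z,t)=\varrho(z_n^+,t-t_n)$ for all $t\ge t_n$; otherwise let $s_n=\phi(z_n^+)$, $t_{n+1}=t_n+s_n$, $\tilde\varrho(z,t)=\varrho(z_n^+,t-t_n)$ for $t_n\le t<t_{n+1}$, $z_{n+1}=\varrho(z_n^+,s_n)\in M$, $z_{n+1}^+=I(z_{n+1})$, and $\tilde\varrho(z,t_{n+1})=z_{n+1}^+$. Strong Tube Condition (STC): a point $z\in M$ satisfies STC if there are $\lambda>0$ and closed sets $S,L\subset Z$ with $z\in S$ such that $F(L,\lambda)=S$; $F(L,[0,2\lambda])$ is a neighborhood of $z$; $F(L,\mu)\cap F(L,\nu)=\emptyset$ for $0\le\mu<\nu\le 2\lambda$; and $S=M\cap F(L,[0,2\lambda])$. Standing assumptions on every ISS: no initial point of $(Z,\varrho)$ belongs to $M$ and every element of $M$ satisfies STC (consequently $\phi$ is continuous on $Z\setminus M$); $M\cap I(M)=\emptyset$; and $\tilde\varrho(z,t)$ is defined for all $t\ge 0$ and all $z\in Z$. Here $(X,\rho_X)$ and $(Y,\rho_Y)$ are metric spaces, and $\tilde\pi,\tilde\sigma$ denote the impulsive trajectories in $(X,\pi;M_X,I_X)$ and $(Y,\sigma;M_Y,I_Y)$. The impulsive positive orbit is $\tilde\pi^+(x)=\{\tilde\pi(x,t):t\ge0\}$;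 the overline denotes closure. The positive limit set $\tilde L_Y^+(y)$ is the set of all $q\in Y$ for which there is a sequence $\lambda_n\to+\infty$ in $\mathbb R_+$ with $\tilde\sigma(y,\lambda_n)\to q$. A mapping $h:X\to Y$ is an $I$-homomorphism (from $(X,\pi;M_X,I_X)$ to $(Y,\sigma;M_Y,I_Y)$) if (a) $h$ is continuous on $X$; (b) $h(\tilde\pi(z,t))=\tilde\sigma(h(z),t)$ for all $z\in X\setminus M_X$ and $t\ge0$; (c) $h(\tilde\pi(I_X(z),t))=\tilde\sigma(h(I_X(z)),t)$ for all $z\in M_X$ and $t\ge0$. For a system $(Z,\varrho;M,I)$ and $z\in Z$, $\mathcal L_z^{+\infty}$ is the set of sequences $\{t_n\}_{n\in\mathbb N}\subset\mathbb R_+$ with $t_n\to+\infty$ such that $\{\tilde\varrho(z,t_n)\}_{n\in\mathbb N}$ converges to some point of $Z$. A point $a$ of one system is comparable in limit with a point $b$ of another if $\mathcal L_b^{+\infty}\subset\mathcal L_a^{+\infty}$. *)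

theory Defs
  imports "HOL-Analysis.Analysis"
begin

text \<open>
  The phase space is the universe of a type of class \<open>metric_space\<close>. A map on
  \<open>Z \<times> [0, \<infinity>)\<close> is a curried function on \<open>'a \<times> real\<close> whose values at negative times
  are irrelevant, and an impulse map on \<open>M\<close> is a total function whose values outside \<open>M\<close> are
  irrelevant.
\<close>

locale semidynamical_system =
  fixes \<rho> :: "'a::metric_space \<Rightarrow> real \<Rightarrow> 'a"
  assumes continuous: "continuous_on (UNIV \<times> {0..}) (\<lambda>(z, t). \<rho> z t)"
    and zero: "\<rho> z 0 = z"
    and semigroup: "0 \<le> t \<Longrightarrow> 0 \<le> s \<Longrightarrow> \<rho> (\<rho> z t) s = \<rho> z (t + s)"

definition funnel :: "('a \<Rightarrow> real \<Rightarrow> 'a) \<Rightarrow> 'a set \<Rightarrow> real set \<Rightarrow> 'a set" where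
  "funnel \<rho> D \<Delta> = (\<Union>z\<in>D. \<Union>t\<in>\<Delta>. {w. \<rho> w t = z})"

definition initial_point :: "('a \<Rightarrow> real \<Rightarrow> 'a) \<Rightarrow> 'a \<Rightarrow> bool" where
  "initial_point \<rho> z \<longleftrightarrow> (\<forall>t>0. funnel \<rho> {z} {t} = {})"

locale impulsive_system = semidynamical_system \<rho>
  for \<rho> :: "'a::metric_space \<Rightarrow> real \<Rightarrow> 'a" +
  fixes M :: "'a set" and I :: "'a \<Rightarrow> 'a"
  assumes M_nonempty: "M \<noteq> {}"
    and M_closed: "closed M"
    and M_isolated: "z \<in> M \<Longrightarrow>
      \<exists>\<epsilon>>0. funnel \<rho> {z} {0<..<\<epsilon>} \<inter> M = {} \<and> \<rho> z ` {0<..<\<epsilon>} \<inter> M = {}"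
    and I_continuous: "continuous_on M I"

definition impact_time :: "('a \<Rightarrow> real \<Rightarrow> 'a) \<Rightarrow> 'a set \<Rightarrow> 'a \<Rightarrow> ereal" where
  "impact_time \<rho> M z =
     (if \<exists>s>0. \<rho> z s \<in> M then ereal (LEAST s. 0 < s \<and> \<rho> z s \<in> M) else \<infinity>)"

text \<open>
  \<open>impulse_stage \<rho> M I z n u \<tau>\<close> says that the construction of the impulsive trajectory of
  \<open>z\<close> reaches its \<open>n\<close>-th stage, with \<open>z\<^sub>n\<^sup>+ = u\<close> and \<open>t\<^sub>n = \<tau>\<close>.
\<close>

inductive impulse_stage ::
    "('a \<Rightarrow> real \<Rightarrow> 'a) \<Rightarrow> 'a set \<Rightarrow> ('a \<Rightarrow> 'a) \<Rightarrow> 'a \<Rightarrow> nat \<Rightarrow> 'a \<Rightarrow> real \<Rightarrow> bool"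
  for \<rho> M I z where
  start: "impulse_stage \<rho> M I z 0 z 0"
| jump: "impulse_stage \<rho> M I z n u \<tau> \<Longrightarrow> impact_time \<rho> M u = ereal s \<Longrightarrow>
    impulse_stage \<rho> M I z (Suc n) (I (\<rho> u s)) (\<tau> + s)"

text \<open>
  The trajectory may fail to be defined at \<open>t\<close>, when the \<open>t\<^sub>n\<close> accumulate at or before \<open>t\<close>;
  so it is first given as a relation. In an impulsive system the relation is single-valued, since
  the impact times are positive.
\<close>

definition impulsive_value ::
    "('a \<Rightarrow> real \<Rightarrow> 'a) \<Rightarrow> 'a set \<Rightarrow> ('a \<Rightarrow> 'a) \<Rightarrow> 'a \<Rightarrow> real \<Rightarrow> 'a \<Rightarrow> bool" where
  "impulsive_value \<rho> M I z t w \<longleftrightarrow>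
     (\<exists>n u \<tau>. impulse_stage \<rho> M I z n u \<tau> \<and> \<tau> \<le> t \<and> ereal t < ereal \<tau> + impact_time \<rho> M u \<and>
        w = \<rho> u (t - \<tau>))"

definition impulsive_trajectory ::
    "('a \<Rightarrow> real \<Rightarrow> 'a) \<Rightarrow> 'a set \<Rightarrow> ('a \<Rightarrow> 'a) \<Rightarrow> 'a \<Rightarrow> real \<Rightarrow> 'a" where
  "impulsive_trajectory \<rho> M I z t = (THE w. impulsive_value \<rho> M I z t w)"

definition strong_tube_condition ::
    "('a::metric_space \<Rightarrow> real \<Rightarrow> 'a) \<Rightarrow> 'a set \<Rightarrow> 'a \<Rightarrow> bool" where
  "strong_tube_condition \<rho> M z \<longleftrightarrow>
     (\<exists>\<kappa>>0. \<exists>S L. closed S \<and> closed L \<and> z \<in> S \<and>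
        funnel \<rho> L {\<kappa>} = S \<and>
        z \<in> interior (funnel \<rho> L {0..2*\<kappa>}) \<and>
        (\<forall>\<mu> \<nu>. 0 \<le> \<mu> \<and> \<mu> < \<nu> \<and> \<nu> \<le> 2*\<kappa> \<longrightarrow> funnel \<rho> L {\<mu>} \<inter> funnel \<rho> L {\<nu>} = {}) \<and>
        S = M \<inter> funnel \<rho> L {0..2*\<kappa>})"

locale standing_impulsive_system = impulsive_system +
  assumes no_initial_point: "z \<in> M \<Longrightarrow> \<not> initial_point \<rho> z"
    and STC: "z \<in> M \<Longrightarrow> strong_tube_condition \<rho> M z"
    and M_disjoint: "M \<inter> I ` M = {}"
    and trajectory_defined: "0 \<le> t \<Longrightarrow> \<exists>w. impulsive_value \<rho> M I z t w"

definition impulsive_orbit ::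
    "('a \<Rightarrow> real \<Rightarrow> 'a) \<Rightarrow> 'a set \<Rightarrow> ('a \<Rightarrow> 'a) \<Rightarrow> 'a \<Rightarrow> 'a set" where
  "impulsive_orbit \<rho> M I z = impulsive_trajectory \<rho> M I z ` {0..}"

definition impulsive_limit_set ::
    "('a::metric_space \<Rightarrow> real \<Rightarrow> 'a) \<Rightarrow> 'a set \<Rightarrow> ('a \<Rightarrow> 'a) \<Rightarrow> 'a \<Rightarrow> 'a set" where
  "impulsive_limit_set \<rho> M I z =
     {q. \<exists>t :: nat \<Rightarrow> real. (\<forall>n. 0 \<le> t n) \<and> filterlim t at_top sequentially \<and>
        (\<lambda>n. impulsive_trajectory \<rho> M I z (t n)) \<longlonglongrightarrow> q}"

definition I_homomorphism ::
    "('a::metric_space \<Rightarrow> real \<Rightarrow> 'a) \<Rightarrow> 'a set \<Rightarrow> ('a \<Rightarrow> 'a) \<Rightarrow>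
     ('b::metric_space \<Rightarrow> real \<Rightarrow> 'b) \<Rightarrow> 'b set \<Rightarrow> ('b \<Rightarrow> 'b) \<Rightarrow> ('a \<Rightarrow> 'b) \<Rightarrow> bool" where
  "I_homomorphism \<pi> M\<^sub>X I\<^sub>X \<sigma> M\<^sub>Y I\<^sub>Y h \<longleftrightarrow>
     continuous_on UNIV h \<and>
     (\<forall>z t. z \<notin> M\<^sub>X \<and> 0 \<le> t \<longrightarrow>
        h (impulsive_trajectory \<pi> M\<^sub>X I\<^sub>X z t) = impulsive_trajectory \<sigma> M\<^sub>Y I\<^sub>Y (h z) t) \<and>
     (\<forall>z t. z \<in> M\<^sub>X \<and> 0 \<le> t \<longrightarrow>
        h (impulsive_trajectory \<pi> M\<^sub>X I\<^sub>X (I\<^sub>X z) t) =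
          impulsive_trajectory \<sigma> M\<^sub>Y I\<^sub>Y (h (I\<^sub>X z)) t)"

definition limit_sequences ::
    "('a::metric_space \<Rightarrow> real \<Rightarrow> 'a) \<Rightarrow> 'a set \<Rightarrow> ('a \<Rightarrow> 'a) \<Rightarrow> 'a \<Rightarrow> (nat \<Rightarrow> real) set" where
  "limit_sequences \<rho> M I z =
     {t. (\<forall>n. 0 \<le> t n) \<and> filterlim t at_top sequentially \<and>
        convergent (\<lambda>n. impulsive_trajectory \<rho> M I z (t n))}"

definition comparable_in_limit ::
    "('a::metric_space \<Rightarrow> real \<Rightarrow> 'a) \<Rightarrow> 'a set \<Rightarrow> ('a \<Rightarrow> 'a) \<Rightarrow> 'a \<Rightarrow>
     ('b::metric_space \<Rightarrow> real \<Rightarrow> 'b) \<Rightarrow> 'b set \<Rightarrow> ('b \<Rightarrow> 'b) \<Rightarrow> 'b \<Rightarrow> bool" where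
  "comparable_in_limit \<pi> M\<^sub>X I\<^sub>X a \<sigma> M\<^sub>Y I\<^sub>Y b \<longleftrightarrow>
     limit_sequences \<sigma> M\<^sub>Y I\<^sub>Y b \<subseteq> limit_sequences \<pi> M\<^sub>X I\<^sub>X a"

end

theory Submission
  imports Defs
begin

text \<open>Take times \<open>t n\<close> along which the trajectory of \<open>y\<close> converges,
  say to \<open>q\<close>. At these same times the trajectory of \<open>x\<close> stays in a compact
  set, and \<open>h\<close> carries it to the trajectory of \<open>y\<close>. By continuity of
  \<open>h\<close>, every cluster point of the values upstairs lies over \<open>q\<close>; as
  \<open>q\<close> is a limit point of \<open>y\<close>, only one point lies over it. In a compact
  set, a sequence with a single possible cluster point converges, so the whole sequence
  \<open>t\<close> works for \<open>x\<close>. This last principle is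
  \<open>tendsto_of_compact_unique_preimage\<close>.\<close>

lemma tendsto_of_compact_unique_preimage:
  fixes h :: "'a::t2_space \<Rightarrow> 'b::t2_space"
  assumes K: "compact K" "\<forall>\<^sub>F n in F. a n \<in> K"
    and h: "continuous_on K h" "((\<lambda>n. h (a n)) \<longlongrightarrow> q) F"
    and unique: "\<And>z. z \<in> K \<Longrightarrow> h z = q \<Longrightarrow> z = p"
  shows "(a \<longlongrightarrow> p) F"
proof (rule topological_tendstoI)
  fix U assume U: "open U" "p \<in> U"
  \<comment> \<open>All points of \<open>K\<close> over \<open>q\<close> lie in \<open>U\<close>, so
    the image of \<open>K - U\<close> is a closed set missing \<open>q\<close>. This replaces the
    extraction of subsequences and works for any filter.\<close>
  have "compact (K - U)"
    using K(1) U(1) by (rule compact_diff)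
  then have "closed (h ` (K - U))"
    using h(1) by (blast intro: compact_imp_closed compact_continuous_image continuous_on_subset)
  moreover have "q \<notin> h ` (K - U)"
    using unique U(2) by blast
  ultimately have "\<forall>\<^sub>F n in F. h (a n) \<in> - h ` (K - U)"
    by (intro topological_tendstoD[OF h(2)]) auto
  then show "\<forall>\<^sub>F n in F. a n \<in> U"
    using K(2) by eventually_elim blast
qed

theorem theorem4p22:
  fixes \<pi> :: "'a::metric_space \<Rightarrow> real \<Rightarrow> 'a" and M\<^sub>X :: "'a set" and I\<^sub>X :: "'a \<Rightarrow> 'a"
    and \<sigma> :: "'b::metric_space \<Rightarrow> real \<Rightarrow> 'b" and M\<^sub>Y :: "'b set" and I\<^sub>Y :: "'b \<Rightarrow> 'b"
    and h :: "'a \<Rightarrow> 'b" and x :: 'a and y :: 'b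
  assumes "standing_impulsive_system \<pi> M\<^sub>X I\<^sub>X"
    and "standing_impulsive_system \<sigma> M\<^sub>Y I\<^sub>Y"
    and "I_homomorphism \<pi> M\<^sub>X I\<^sub>X \<sigma> M\<^sub>Y I\<^sub>Y h"
    and "x \<in> {z. h z = y} - M\<^sub>X"
    and "compact (closure (impulsive_orbit \<pi> M\<^sub>X I\<^sub>X x))"
    and "\<forall>q \<in> impulsive_limit_set \<sigma> M\<^sub>Y I\<^sub>Y y. \<exists>!p. h p = q"
  shows "comparable_in_limit \<pi> M\<^sub>X I\<^sub>X x \<sigma> M\<^sub>Y I\<^sub>Y y"
  unfolding comparable_in_limit_def
proof
  fix t assume "t \<in> limit_sequences \<sigma> M\<^sub>Y I\<^sub>Y y"
  then obtain q where t: "\<forall>n. 0 \<le> t n" "filterlim t at_top sequentially"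
    and q: "(\<lambda>n. impulsive_trajectory \<sigma> M\<^sub>Y I\<^sub>Y y (t n)) \<longlonglongrightarrow> q"
    by (auto simp: limit_sequences_def convergent_def)
  let ?a = "\<lambda>n. impulsive_trajectory \<pi> M\<^sub>X I\<^sub>X x (t n)"
  \<comment> \<open>The sequence \<open>t\<close> itself witnesses that \<open>q\<close> is a limit
    point, which makes the fibre hypothesis available at \<open>q\<close>.\<close>
  have "q \<in> impulsive_limit_set \<sigma> M\<^sub>Y I\<^sub>Y y"
    using t q unfolding impulsive_limit_set_def by blast
  then obtain p where p: "\<And>z. h z = q \<Longrightarrow> z = p"
    using assms(6) by blast
  have h_cont: "continuous_on UNIV h"
    using assms(3) by (simp add: I_homomorphism_def)
  \<comment> \<open>Since \<open>x\<close> is outside \<open>M\<^sub>X\<close> and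
    \<open>h x = y\<close>, the homomorphism clause for points off the impulse set applies.\<close>
  have h_a: "h (?a n) = impulsive_trajectory \<sigma> M\<^sub>Y I\<^sub>Y y (t n)" for n
    using assms(3,4) t(1) by (auto simp: I_homomorphism_def)
  have a_orbit: "?a n \<in> closure (impulsive_orbit \<pi> M\<^sub>X I\<^sub>X x)" for n
    using t(1) closure_subset unfolding impulsive_orbit_def by fastforce
  have "?a \<longlonglongrightarrow> p"
  proof (rule tendsto_of_compact_unique_preimage[OF assms(5)])
    show "continuous_on (closure (impulsive_orbit \<pi> M\<^sub>X I\<^sub>X x)) h"
      using h_cont by (rule continuous_on_subset) simp
    show "(\<lambda>n. h (?a n)) \<longlonglongrightarrow> q"
      using q by (simp add: h_a)
  qed (use a_orbit p in auto)
  then show "t \<in> limit_sequences \<pi> M\<^sub>X I\<^sub>X x"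
    using t by (auto simp: limit_sequences_def convergent_def)
qed

end
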